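(* Let $m,n\ge1$ be integers, $0<\theta\le1$, and consider the extended occupancy process with $m$ bins and probability parameter $\theta$. Let $n_{\mathrm{eff}}=\sum_{i=1}^n\mathbb{I}(U_i\ne\bullet)$ be the effective number of balls among the first $n$. Let $1\le k\le\min(n,m)$. Then for $r=0,\dots,n-k$, $$\mathbb{P}(n_{\mathrm{eff}}-K_n=r\mid K_n=k)=\operatorname{Spillage}\Big(r\,\Big|\,n,k,m\cdot\frac{1-\theta}{\theta}\Big),$$ and for $s=k,\dots,n$, $$\mathbb{P}(n_{\mathrm{eff}}=s\mid K_n=k)=\operatorname{Spillage}\Big(s-k\,\Big|\,n,k,m\cdot\frac{1-\theta}{\theta}\Big).$$
   Context: Extended occupancy process: let $\tilde U_1,\tilde U_2,\dots$ be IID uniform on $\{1,\dots,m\}$ and $Q_1,Q_2,\dots$ be IID Bernoulli$(\theta)$, the two sequences independent of each other. Let $\bullet\notin\{1,\dots,m\}$ and set $U_i=\bullet$ if $Q_i=0$, $U_i=\tilde U_i$ if $Q_i=1$. The occupancy number is $K_n=\sum_{\ell=1}^m\mathbb{I}\big(\sum_{i=1}^n\mathbb{I}(U_i=\ell)>0\big)$. Noncentral Stirling numbers of the second kind: for an integer $n\ge0$ and real $\phi$, the numbers $S(n,k,\phi)$, $0\le k\le n$, are defined by the polynomial identity $(x+\phi)^n=\sum_{k=0}^n S(n,k,\phi)(x)_k$, where $(x)_k=\prod_{i=0}^{k-1}(x-i)$; $S(n,k,\phi)=0$ for $k>n$; and $S(n,k)=S(n,k,0)$. Spillage distribution: for integers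 $0\le k\le n$, $0<\phi<\infty$ and $r=0,\dots,n-k$, $\operatorname{Spillage}(r\mid n,k,\phi)=\binom{n}{k+r}\phi^{\,n-k-r}\frac{S(k+r,k)}{S(n,k,\phi)}$; for $\phi=0$, $\operatorname{Spillage}(r\mid n,k,0)=\mathbb{I}(r=n-k)$. *)

theory Defs
  imports "HOL-Probability.Probability" "HOL-Computational_Algebra.Polynomial"
begin

definition falling_poly :: "nat \<Rightarrow> real poly"
  where "falling_poly k = (\<Prod>i<k. [:- of_nat i, 1:])"

(* The polynomial identity (x + phi)^n = (SUM k<=n. S(n,k,phi) * (x)_k) in real[x], extended by
   zero for k > n.  Theorem noncentral_stirling_ex1 below shows that it determines the numbers. *)
definition noncentral_stirling :: "nat \<Rightarrow> nat \<Rightarrow> real \<Rightarrow> real"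
  where "noncentral_stirling n k \<phi> =
    (THE S :: nat \<Rightarrow> real. (\<forall>j>n. S j = 0) \<and>
       [:\<phi>, 1:] ^ n = (\<Sum>j\<le>n. smult (S j) (falling_poly j))) k"

definition spillage :: "nat \<Rightarrow> nat \<Rightarrow> nat \<Rightarrow> real \<Rightarrow> real"
  where "spillage r n k \<phi> =
    (if \<phi> = 0 then of_bool (r = n - k)
     else of_nat (n choose (k + r)) * \<phi> ^ (n - (k + r)) *
          noncentral_stirling (k + r) k 0 / noncentral_stirling n k \<phi>)"

(* The sequences are indexed by 1, 2, ...; the values at index 0 are irrelevant. *)
locale extended_occupancy = prob_space M
  for M :: "'a measure" +
  fixes m :: nat and \<theta> :: real
    and Ut :: "nat \<Rightarrow> 'a \<Rightarrow> nat" and Q :: "nat \<Rightarrow> 'a \<Rightarrow> nat"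
  assumes Ut_indep: "indep_vars (\<lambda>_. count_space UNIV) Ut {1..}"
    and Ut_distr: "\<And>i. i \<ge> 1 \<Longrightarrow> distr M (count_space UNIV) (Ut i) = measure_pmf (pmf_of_set {1..m})"
    and Q_indep: "indep_vars (\<lambda>_. count_space UNIV) Q {1..}"
    and Q_distr: "\<And>i. i \<ge> 1 \<Longrightarrow> distr M (count_space UNIV) (Q i) =
                                measure_pmf (map_pmf of_bool (bernoulli_pmf \<theta>))"
    and Ut_Q_indep:
      "indep_var (Pi\<^sub>M {1..} (\<lambda>_. count_space UNIV)) (\<lambda>\<omega>. \<lambda>i\<in>{1..}. Ut i \<omega>)
                 (Pi\<^sub>M {1..} (\<lambda>_. count_space UNIV)) (\<lambda>\<omega>. \<lambda>i\<in>{1..}. Q i \<omega>)"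

(* None is the extra point outside {1..m}. *)
definition occ_ball :: "(nat \<Rightarrow> 'a \<Rightarrow> nat) \<Rightarrow> (nat \<Rightarrow> 'a \<Rightarrow> nat) \<Rightarrow> nat \<Rightarrow> 'a \<Rightarrow> nat option"
  where "occ_ball Ut Q i \<omega> = (if Q i \<omega> = 0 then None else Some (Ut i \<omega>))"

definition occupancy_number :: "nat \<Rightarrow> (nat \<Rightarrow> 'a \<Rightarrow> nat option) \<Rightarrow> nat \<Rightarrow> 'a \<Rightarrow> nat"
  where "occupancy_number m U n \<omega> =
    (\<Sum>l=1..m. of_bool ((\<Sum>i=1..n. of_bool (U i \<omega> = Some l) :: nat) > 0))"

definition effective_balls :: "(nat \<Rightarrow> 'a \<Rightarrow> nat option) \<Rightarrow> nat \<Rightarrow> 'a \<Rightarrow> nat"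
  where "effective_balls U n \<omega> = (\<Sum>i=1..n. of_bool (U i \<omega> \<noteq> None))"

lemma falling_poly_monic: "degree (falling_poly k) = k \<and> coeff (falling_poly k) k = 1"
proof (induction k)
  case 0
  show ?case by (simp add: falling_poly_def)
next
  case (Suc k)
  have eq: "falling_poly (Suc k) = falling_poly k * [:- of_nat k, 1:]"
    by (simp add: falling_poly_def mult.commute)
  from Suc have nz: "falling_poly k \<noteq> 0" by auto
  have d: "degree (falling_poly (Suc k)) = Suc k"
    unfolding eq using Suc nz by (subst degree_mult_eq) auto
  have "lead_coeff (falling_poly (Suc k)) = 1"
    unfolding eq lead_coeff_mult using Suc by simp
  with d show ?case by simp
qed

lemma falling_poly_expansion:
  assumes "degree p \<le> n"
  shows "\<exists>S. (\<forall>j>n. S j = 0) \<and> p = (\<Sum>j\<le>n. smult (S j) (falling_poly j))"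
  using assms
proof (induction n arbitrary: p)
  case 0
  then obtain c where "p = [:c:]" by (metis degree_eq_zeroE le_0_eq)
  then show ?case
    by (intro exI[of _ "\<lambda>j. if j = 0 then c else 0"]) (simp add: falling_poly_def)
next
  case (Suc n)
  define c where "c = coeff p (Suc n)"
  define q where "q = p - smult c (falling_poly (Suc n))"
  have "degree q \<le> n"
  proof (rule degree_le, intro allI impI)
    fix i assume "n < i"
    then consider "i = Suc n" | "i > Suc n" by linarith
    then show "coeff q i = 0"
    proof cases
      case 1
      then show ?thesis using falling_poly_monic[of "Suc n"] by (simp add: q_def c_def)
    next
      case 2
      then have "coeff p i = 0" "coeff (falling_poly (Suc n)) i = 0"
        using Suc.prems falling_poly_monic[of "Suc n"] by (auto intro!: coeff_eq_0)
      then show ?thesis by (simp add: q_def)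
    qed
  qed
  from Suc.IH[OF this] obtain S
    where S: "\<forall>j>n. S j = 0" "q = (\<Sum>j\<le>n. smult (S j) (falling_poly j))" by blast
  have "(\<Sum>j\<le>n. smult ((S(Suc n := c)) j) (falling_poly j)) = q"
    unfolding S(2) by (rule sum.cong) auto
  then have "p = (\<Sum>j\<le>Suc n. smult ((S(Suc n := c)) j) (falling_poly j))"
    by (simp add: q_def)
  moreover have "\<forall>j>Suc n. (S(Suc n := c)) j = 0" using S(1) by simp
  ultimately show ?case by blast
qed

lemma falling_poly_independent:
  assumes "(\<Sum>j\<le>n. smult (S j) (falling_poly j)) = 0" "j \<le> n"
  shows "S j = 0"
  using assms
proof (induction n arbitrary: j)
  case 0
  then show ?case by (simp add: falling_poly_def)
next
  case (Suc n)
  have "coeff (\<Sum>j\<le>n. smult (S j) (falling_poly j)) (Suc n) = 0"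
    unfolding coeff_sum using falling_poly_monic
    by (intro sum.neutral) (auto intro!: coeff_eq_0)
  moreover have "coeff (\<Sum>j\<le>Suc n. smult (S j) (falling_poly j)) (Suc n) = 0"
    using Suc.prems(1) by simp
  ultimately have c: "S (Suc n) = 0"
    using falling_poly_monic[of "Suc n"] by simp
  with Suc show ?case by (cases "j = Suc n") auto
qed

theorem noncentral_stirling_ex1:
  "\<exists>!S :: nat \<Rightarrow> real. (\<forall>j>n. S j = 0) \<and>
     [:\<phi>, 1:] ^ n = (\<Sum>j\<le>n. smult (S j) (falling_poly j))"
proof (rule ex_ex1I)
  have "degree ([:\<phi>, 1:] ^ n) \<le> n"
    using degree_power_le[of "[:\<phi>, 1:]" n] by simp
  from falling_poly_expansion[OF this]
  show "\<exists>S. (\<forall>j>n. S j = 0) \<and> [:\<phi>, 1:] ^ n = (\<Sum>j\<le>n. smult (S j) (falling_poly j))" .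
next
  fix S T :: "nat \<Rightarrow> real"
  assume S: "(\<forall>j>n. S j = 0) \<and> [:\<phi>, 1:] ^ n = (\<Sum>j\<le>n. smult (S j) (falling_poly j))"
    and T: "(\<forall>j>n. T j = 0) \<and> [:\<phi>, 1:] ^ n = (\<Sum>j\<le>n. smult (T j) (falling_poly j))"
  have "(\<Sum>j\<le>n. smult (S j - T j) (falling_poly j)) = 0"
    using S T by (simp add: smult_diff_left sum_subtractf)
  from falling_poly_independent[OF this] S T show "S = T"
    by (metis eq_iff_diff_eq_0 ext not_le)
qed

end

theory Submission
  imports Defs
begin

text \<open>A new ball is lost with probability \<open>1 - \<theta>\<close> and otherwise hits one of the \<open>k\<close> occupied or one of
  the \<open>m - k\<close> empty bins, each with probability \<open>\<theta> / m\<close>. Together with the Stirling recurrence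
  \<open>S(n+1,k,\<phi>) = (k + \<phi>) S(n,k,\<phi>) + S(n,k-1,\<phi>)\<close> this gives by induction the joint law
  \<open>P(n_eff = s, K_n = k) = (n choose s) (1 - \<theta>)^(n-s) (\<theta> / m)^s (m)_k S(s,k)\<close>. Expanding
  \<open>(x + \<phi>)^n\<close> binomially shows \<open>(\<Sum>s. (n choose s) \<phi>^(n-s) S(s,k)) = S(n,k,\<phi>)\<close>, so for
  \<open>\<phi> = m (1 - \<theta>) / \<theta>\<close> summation over \<open>s\<close> yields \<open>P(K_n = k) = (\<theta> / m)^n (m)_k S(n,k,\<phi>)\<close>; the
  quotient is the spillage distribution.\<close>

section \<open>Noncentral Stirling numbers: recurrence, positivity and convolution\<close>

lemma noncentral_stirling_expansion:
  "[:\<phi>, 1:] ^ n = (\<Sum>j\<le>n. smult (noncentral_stirling n j \<phi>) (falling_poly j))"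
  and noncentral_stirling_eq_0: "j > n \<Longrightarrow> noncentral_stirling n j \<phi> = 0"
  using theI'[OF noncentral_stirling_ex1[of n \<phi>]] unfolding noncentral_stirling_def by auto

text \<open>Reduces an identity for these numbers to exhibiting an expansion in the falling
  factorial basis; the recurrence, the initial values and the convolution are all obtained this
  way.\<close>

lemma noncentral_stirling_unique:
  assumes "\<And>j. j > n \<Longrightarrow> S j = 0"
    and "[:\<phi>, 1:] ^ n = (\<Sum>j\<le>n. smult (S j) (falling_poly j))"
  shows "noncentral_stirling n j \<phi> = S j"
  unfolding noncentral_stirling_def
  by (rule fun_cong[OF the1_equality[OF noncentral_stirling_ex1]]) (use assms in auto)

text \<open>Split x + \<phi> = (x - j) + (j + \<phi>): the first summand extends the falling
  factorial by one factor, the second is a scalar.\<close>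

lemma falling_poly_mult_linear:
  "[:\<phi>, 1:] * falling_poly j = falling_poly (Suc j) + smult (of_nat j + \<phi>) (falling_poly j)"
proof -
  have "falling_poly (Suc j) = [:- of_nat j, 1:] * falling_poly j"
    by (simp add: falling_poly_def mult.commute)
  moreover have "[:\<phi>, 1:] = [:- of_nat j, 1:] + [:of_nat j + \<phi>:]"
    by simp
  ultimately show ?thesis
    by (simp add: distrib_right del: mult_pCons_left add_pCons) simp
qed

lemma noncentral_stirling_rec:
  "noncentral_stirling (Suc n) k \<phi> =
     (of_nat k + \<phi>) * noncentral_stirling n k \<phi> +
     (if k = 0 then 0 else noncentral_stirling n (k - 1) \<phi>)"
proof (rule noncentral_stirling_unique)
  let ?S = "\<lambda>j. noncentral_stirling n j \<phi>"
  show "(of_nat j + \<phi>) * ?S j + (if j = 0 then 0 else ?S (j - 1)) = 0" if "j > Suc n" for j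
    using that by (auto simp: noncentral_stirling_eq_0)
  have "[:\<phi>, 1:] ^ Suc n = (\<Sum>j\<le>n. smult (?S j) ([:\<phi>, 1:] * falling_poly j))"
    by (simp only: power_Suc noncentral_stirling_expansion sum_distrib_left mult_smult_right)
  also have "\<dots> = (\<Sum>j\<le>n. smult ((of_nat j + \<phi>) * ?S j) (falling_poly j)) +
                  (\<Sum>j\<le>n. smult (?S j) (falling_poly (Suc j)))"
    unfolding falling_poly_mult_linear
    by (simp add: smult_add_right sum.distrib mult.commute add.commute)
  \<comment> \<open>The added term j = n + 1 vanishes because S(n, n+1, \<phi>) = 0.\<close>
  also have "(\<Sum>j\<le>n. smult ((of_nat j + \<phi>) * ?S j) (falling_poly j)) =
             (\<Sum>j\<le>Suc n. smult ((of_nat j + \<phi>) * ?S j) (falling_poly j))"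
    by (simp add: noncentral_stirling_eq_0)
  also have "(\<Sum>j\<le>n. smult (?S j) (falling_poly (Suc j))) =
             (\<Sum>j\<le>Suc n. smult (if j = 0 then 0 else ?S (j - 1)) (falling_poly j))"
    by (subst sum.atMost_Suc_shift) simp
  finally show "[:\<phi>, 1:] ^ Suc n =
      (\<Sum>j\<le>Suc n. smult ((of_nat j + \<phi>) * ?S j + (if j = 0 then 0 else ?S (j - 1))) (falling_poly j))"
    by (simp only: smult_add_left sum.distrib)
qed

lemma noncentral_stirling_0: "noncentral_stirling 0 k \<phi> = of_bool (k = 0)"
  by (rule noncentral_stirling_unique) (auto simp: falling_poly_def)

text \<open>For \<phi> \<ge> 0 the recurrence has nonnegative coefficients, so all the numbers are
  nonnegative. Starting from the diagonal value 1, each increase of n multiplies by k + \<phi>,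
  positive since k \<ge> 1, and adds a nonnegative term.\<close>

lemma noncentral_stirling_pos:
  assumes "\<phi> \<ge> 0" "1 \<le> k" "k \<le> n"
  shows "noncentral_stirling n k \<phi> > 0"
proof -
  have nonneg: "noncentral_stirling n k \<phi> \<ge> 0" for n k
    using assms(1) by (induction n arbitrary: k) (auto simp: noncentral_stirling_0 noncentral_stirling_rec)
  have "noncentral_stirling n n \<phi> = 1" for n
    by (induction n) (auto simp: noncentral_stirling_0 noncentral_stirling_rec noncentral_stirling_eq_0)
  moreover have "noncentral_stirling (k + d) k \<phi> > 0" if "noncentral_stirling k k \<phi> > 0" for d
    using assms that
    by (induction d) (auto simp: noncentral_stirling_rec intro!: add_pos_nonneg mult_pos_pos nonneg)
  ultimately show ?thesis
    using assms(3) by (metis le_add_diff_inverse zero_less_one)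
qed

lemma smult_sum_right:
  fixes f :: "'a \<Rightarrow> 'b :: comm_semiring_0 poly"
  shows "smult c (\<Sum>i\<in>A. f i) = (\<Sum>i\<in>A. smult c (f i))"
  by (induction A rule: infinite_finite_induct) (auto simp: smult_add_right)

lemma noncentral_stirling_convolution:
  "(\<Sum>s\<le>n. of_nat (n choose s) * \<phi> ^ (n - s) * noncentral_stirling s k 0) = noncentral_stirling n k \<phi>"
proof (rule noncentral_stirling_unique[symmetric])
  show "(\<Sum>s\<le>n. of_nat (n choose s) * \<phi> ^ (n - s) * noncentral_stirling s j 0) = 0" if "j > n" for j
    using that by (intro sum.neutral) (auto simp: noncentral_stirling_eq_0)
  \<comment> \<open>Padding with zero terms up to n makes the range of j independent of s, so that
    the two sums can be swapped.\<close>
  have ext: "[:0, 1:] ^ s = (\<Sum>j\<le>n. smult (noncentral_stirling s j 0) (falling_poly j))"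
    if "s \<le> n" for s
    unfolding noncentral_stirling_expansion[of 0 s] using that
    by (intro sum.mono_neutral_left) (auto simp: noncentral_stirling_eq_0)
  have "[:\<phi>, 1:] ^ n = ([:0, 1:] + [:\<phi>:]) ^ n"
    by simp
  also have "\<dots> = (\<Sum>s\<le>n. smult (of_nat (n choose s) * \<phi> ^ (n - s)) ([:0, 1:] ^ s))"
    unfolding binomial_ring
    by (intro sum.cong refl)
       (simp add: of_nat_poly poly_const_pow mult.commute mult.left_commute)
  also have "\<dots> = (\<Sum>s\<le>n. \<Sum>j\<le>n. smult (of_nat (n choose s) * \<phi> ^ (n - s) * noncentral_stirling s j 0)
                                     (falling_poly j))"
    by (intro sum.cong refl) (simp add: ext smult_sum_right)
  also have "\<dots> = (\<Sum>j\<le>n. smult (\<Sum>s\<le>n. of_nat (n choose s) * \<phi> ^ (n - s) * noncentral_stirling s j 0)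
                                     (falling_poly j))"
    by (subst sum.swap) (simp add: smult_sum)
  finally show "[:\<phi>, 1:] ^ n = \<dots>" .
qed

section \<open>Weighted enumeration of the finite ball sequences\<close>

definition ball_seqs :: "nat \<Rightarrow> nat \<Rightarrow> (nat \<Rightarrow> nat option) set"
  where "ball_seqs m n = {1..n} \<rightarrow>\<^sub>E insert None (Some ` {1..m})"

text \<open>A sequence \<open>u\<close> is its own sample point, on which the process is \<open>U i u = u i\<close>.\<close>

abbreviation seq_effective :: "nat \<Rightarrow> (nat \<Rightarrow> nat option) \<Rightarrow> nat"
  where "seq_effective n u \<equiv> effective_balls (\<lambda>i u. u i) n u"

abbreviation seq_occupancy :: "nat \<Rightarrow> nat \<Rightarrow> (nat \<Rightarrow> nat option) \<Rightarrow> nat"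
  where "seq_occupancy m n u \<equiv> occupancy_number m (\<lambda>i u. u i) n u"

text \<open>The weights stay free parameters, which makes the enumeration pure algebra. The process
  later supplies \<open>a\<close> = 1 - \<theta> for a lost ball and \<open>b\<close> = \<theta> / m
  for each single bin.\<close>

definition ball_weight :: "real \<Rightarrow> real \<Rightarrow> nat option \<Rightarrow> real"
  where "ball_weight a b x = (if x = None then a else b)"

definition seq_weight :: "real \<Rightarrow> real \<Rightarrow> nat \<Rightarrow> (nat \<Rightarrow> nat option) \<Rightarrow> real"
  where "seq_weight a b n u = (\<Prod>i=1..n. ball_weight a b (u i))"

lemma finite_ball_seqs: "finite (ball_seqs m n)"
  by (auto simp: ball_seqs_def intro!: finite_PiE)

text \<open>Splits off the last ball: a sequence of length n + 1 arises from exactly one sequence of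
  length n and one value at \<open>Suc n\<close>.\<close>

lemma sum_ball_seqs_Suc:
  fixes f :: "(nat \<Rightarrow> nat option) \<Rightarrow> 'b :: comm_monoid_add"
  shows "(\<Sum>u\<in>ball_seqs m (Suc n). f u) =
         (\<Sum>u\<in>ball_seqs m n. f (u(Suc n := None)) + (\<Sum>l=1..m. f (u(Suc n := Some l))))"
proof -
  let ?X = "insert None (Some ` {1..m})"
  have "ball_seqs m (Suc n) = (\<lambda>(x, u). u(Suc n := x)) ` (?X \<times> ball_seqs m n)"
    unfolding ball_seqs_def by (simp add: atLeastAtMostSuc_conv PiE_insert_eq)
  moreover have "inj_on (\<lambda>(x, u). u(Suc n := x)) (?X \<times> ball_seqs m n)"
    unfolding ball_seqs_def by (rule inj_combinator) simp
  ultimately have "(\<Sum>u\<in>ball_seqs m (Suc n). f u) = (\<Sum>(x, u)\<in>?X \<times> ball_seqs m n. f (u(Suc n := x)))"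
    by (simp add: sum.reindex case_prod_unfold)
  also have "\<dots> = (\<Sum>u\<in>ball_seqs m n. \<Sum>x\<in>?X. f (u(Suc n := x)))"
    by (subst sum.cartesian_product[symmetric]) (rule sum.swap)
  also have "\<dots> = (\<Sum>u\<in>ball_seqs m n. f (u(Suc n := None)) + (\<Sum>l=1..m. f (u(Suc n := Some l))))"
    by (intro sum.cong refl, subst sum.insert) (auto simp: sum.reindex)
  finally show ?thesis .
qed

lemma seq_effective_upd:
  "seq_effective (Suc n) (u(Suc n := x)) = seq_effective n u + of_bool (x \<noteq> None)"
  by (simp add: effective_balls_def)

lemma seq_weight_upd: "seq_weight a b (Suc n) (u(Suc n := x)) = seq_weight a b n u * ball_weight a b x"
  by (simp add: seq_weight_def)

lemma occupancy_number_eq_card: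
  "occupancy_number m U n \<omega> = card {l \<in> {1..m}. \<exists>i\<in>{1..n}. U i \<omega> = Some l}"
proof -
  have "((\<Sum>i=1..n. of_bool (U i \<omega> = Some l) :: nat) > 0) \<longleftrightarrow> (\<exists>i\<in>{1..n}. U i \<omega> = Some l)" for l
    unfolding neq0_conv[symmetric] by (subst sum_eq_0_iff) auto
  then show ?thesis
    by (simp add: occupancy_number_def of_bool_def sum.If_cases Int_def conj_commute)
qed

lemma seq_occupancy_upd_None: "seq_occupancy m (Suc n) (u(Suc n := None)) = seq_occupancy m n u"
  by (simp add: occupancy_number_def)

text \<open>The new ball inserts \<open>l\<close> into the set of occupied bins, whose cardinality
  grows exactly when \<open>l\<close> was still empty.\<close>

lemma seq_occupancy_upd_Some:
  assumes "l \<in> {1..m}"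
  shows "seq_occupancy m (Suc n) (u(Suc n := Some l)) =
         seq_occupancy m n u + of_bool (\<forall>i\<in>{1..n}. u i \<noteq> Some l)"
proof -
  let ?O = "{l \<in> {1..m}. \<exists>i\<in>{1..n}. u i = Some l}"
  have "{j \<in> {1..m}. \<exists>i\<in>{1..Suc n}. (u(Suc n := Some l)) i = Some j} = insert l ?O"
    using assms by (force simp: atLeastAtMostSuc_conv)
  then show ?thesis
    unfolding occupancy_number_eq_card using assms by (auto simp: card_insert_if)
qed

text \<open>Of the \<open>m\<close> bins, the occupied ones leave the occupancy number unchanged and the empty ones
  raise it by one.\<close>

lemma sum_seq_occupancy_upd_Some:
  "(\<Sum>l=1..m. of_bool (seq_occupancy m (Suc n) (u(Suc n := Some l)) = k) :: real) =
     real k * of_bool (seq_occupancy m n u = k) +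
     (real m - real k + 1) * of_bool (seq_occupancy m n u + 1 = k)"
proof -
  let ?K = "seq_occupancy m n u"
  define B where "B = {l \<in> {1..m}. \<exists>i\<in>{1..n}. u i = Some l}"
  have B: "B \<subseteq> {1..m}" "card B = ?K"
    by (auto simp: B_def occupancy_number_eq_card)
  have "(\<Sum>l=1..m. of_bool (seq_occupancy m (Suc n) (u(Suc n := Some l)) = k) :: real) =
        (\<Sum>l=1..m. if l \<in> B then of_bool (?K = k) else of_bool (?K + 1 = k))"
    by (intro sum.cong refl) (auto simp: seq_occupancy_upd_Some B_def)
  also have "\<dots> = real (card B) * of_bool (?K = k) + real (card ({1..m} - B)) * of_bool (?K + 1 = k)"
    using B(1) by (simp add: sum.If_cases Int_absorb1 Diff_eq)
  \<comment> \<open>If \<open>?K + 1 = k\<close>, the number of empty bins is m - (k - 1).\<close>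
  also have "\<dots> = real k * of_bool (?K = k) + (real m - real k + 1) * of_bool (?K + 1 = k)"
    using B card_mono[OF _ B(1)] by (auto simp: card_Diff_subset finite_subset of_nat_diff)
  finally show ?thesis .
qed

text \<open>Induction on n, conditioning on the last ball. The binomial coefficient follows Pascal's
  rule, the Stirling number its recurrence at \<phi> = 0, and filling an empty bin supplies the
  factor m - k + 1 that completes the falling factorial.\<close>

lemma sum_seq_weight:
  "(\<Sum>u\<in>ball_seqs m n. of_bool (seq_effective n u = s \<and> seq_occupancy m n u = k) * seq_weight a b n u) =
     real (n choose s) * a ^ (n - s) * b ^ s * (\<Prod>i<k. real m - real i) * noncentral_stirling s k 0"
proof (induction n arbitrary: s k)
  case 0
  show ?case
    by (cases s; cases k)
       (simp_all add: ball_seqs_def effective_balls_def occupancy_number_def seq_weight_def noncentral_stirling_0)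
next
  case (Suc n)
  let ?H = "\<lambda>s k. \<Sum>u\<in>ball_seqs m n. of_bool (seq_effective n u = s \<and> seq_occupancy m n u = k) * seq_weight a b n u"
  let ?F = "\<lambda>n s k u. of_bool (seq_effective n u = s \<and> seq_occupancy m n u = k) * seq_weight a b n u"
  \<comment> \<open>The guards for s = 0 and k = 0 are needed because \<open>s - 1\<close> and
    \<open>k - 1\<close> truncate: no predecessor state exists there.\<close>
  have occupied: "(\<Sum>l=1..m. ?F (Suc n) s k (u(Suc n := Some l))) =
      (if s = 0 then 0 else b * (real k * ?F n (s - 1) k u +
         (if k = 0 then 0 else (real m - real k + 1) * ?F n (s - 1) (k - 1) u)))" for u
  proof -
    have "(\<Sum>l=1..m. ?F (Suc n) s k (u(Suc n := Some l))) =
        of_bool (seq_effective n u + 1 = s) * b * seq_weight a b n u *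
        (\<Sum>l=1..m. of_bool (seq_occupancy m (Suc n) (u(Suc n := Some l)) = k))"
      unfolding sum_distrib_left
      by (intro sum.cong refl) (simp add: seq_effective_upd seq_weight_upd ball_weight_def of_bool_conj)
    then show ?thesis
      unfolding sum_seq_occupancy_upd_Some by (cases s; cases k) (auto simp: algebra_simps)
  qed
  have "(\<Sum>u\<in>ball_seqs m (Suc n). ?F (Suc n) s k u) =
      (\<Sum>u\<in>ball_seqs m n. a * ?F n s k u + (if s = 0 then 0 else b * (real k * ?F n (s - 1) k u +
         (if k = 0 then 0 else (real m - real k + 1) * ?F n (s - 1) (k - 1) u))))"
    unfolding sum_ball_seqs_Suc occupied
    by (intro sum.cong refl)
       (simp add: seq_effective_upd seq_occupancy_upd_None seq_weight_upd ball_weight_def)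
  also have "\<dots> = a * ?H s k + (if s = 0 then 0 else b * (real k * ?H (s - 1) k +
         (if k = 0 then 0 else (real m - real k + 1) * ?H (s - 1) (k - 1))))"
    by (cases "s = 0"; cases "k = 0") (simp_all add: sum.distrib sum_distrib_left distrib_left)
  also have "\<dots> = real (Suc n choose s) * a ^ (Suc n - s) * b ^ s * (\<Prod>i<k. real m - real i) *
      noncentral_stirling s k 0" (is "?lhs = ?rhs")
  proof (cases s)
    case 0
    then show ?thesis
      by (simp add: Suc.IH)
  next
    case (Suc s')
    \<comment> \<open>For s > n the exponents truncate, but the binomial coefficient is then
      0.\<close>
    have "real (n choose s) * (a * a ^ (n - s)) = real (n choose s) * a ^ (Suc n - s)"
      by (cases "s \<le> n") (auto simp: Suc_diff_le)
    then have none: "a * ?H s k = real (n choose s) * a ^ (n - s') * b ^ s * (\<Prod>i<k. real m - real i) *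
        noncentral_stirling s k 0"
      unfolding Suc.IH using Suc by (simp add: ac_simps)
    \<comment> \<open>The factor m - (k - 1) turns the product up to k - 1 into the one up to k;
      what remains is the Stirling recurrence.\<close>
    have some: "real k * ?H s' k + (if k = 0 then 0 else (real m - real k + 1) * ?H s' (k - 1)) =
        real (n choose s') * a ^ (n - s') * b ^ s' * (\<Prod>i<k. real m - real i) * noncentral_stirling s k 0"
      unfolding Suc.IH using Suc by (cases k) (simp_all add: noncentral_stirling_rec algebra_simps)
    have "?lhs = a * ?H s k + b * (real k * ?H s' k +
        (if k = 0 then 0 else (real m - real k + 1) * ?H s' (k - 1)))"
      using Suc by simp
    \<comment> \<open>Both terms now differ only in the binomial coefficient, so Pascal's rule adds
      them up.\<close>
    also have "\<dots> = ?rhs"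
      unfolding none some using Suc by (simp add: algebra_simps)
    finally show ?thesis .
  qed
  finally show ?case .
qed

text \<open>Here \<phi> is the ratio of the weight of a lost ball to that of a single bin. Each
  joint sum then contains b^n, and the remaining powers of \<phi> are those of the Stirling
  convolution.\<close>

lemma sum_seq_weight_occupancy:
  "(\<Sum>u\<in>ball_seqs m n. of_bool (seq_occupancy m n u = k) * seq_weight (b * \<phi>) b n u) =
     b ^ n * (\<Prod>i<k. real m - real i) * noncentral_stirling n k \<phi>"
proof -
  have le: "seq_effective n u \<le> n" for u
    unfolding effective_balls_def using sum_bounded_above[of "{1..n}" "\<lambda>i. of_bool (u i \<noteq> None)" "1::nat"]
    by simp
  \<comment> \<open>At most n balls are effective, so exactly one s in the inner sum contributes for
    each u.\<close>
  have "(\<Sum>u\<in>ball_seqs m n. of_bool (seq_occupancy m n u = k) * seq_weight (b * \<phi>) b n u) =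
      (\<Sum>u\<in>ball_seqs m n. \<Sum>s\<le>n. of_bool (seq_effective n u = s \<and> seq_occupancy m n u = k) *
         seq_weight (b * \<phi>) b n u)"
    using le by (intro sum.cong refl) (simp add: of_bool_conj sum_distrib_right[symmetric] of_bool_def)
  also have "\<dots> = (\<Sum>s\<le>n. b ^ n * (\<Prod>i<k. real m - real i) *
      (real (n choose s) * \<phi> ^ (n - s) * noncentral_stirling s k 0))"
    unfolding sum.swap[of _ _ "ball_seqs m n"] sum_seq_weight
  proof (intro sum.cong refl)
    fix s assume "s \<in> {..n}"
    then have "b ^ n = b ^ (n - s) * b ^ s"
      by (simp flip: power_add)
    then show "real (n choose s) * (b * \<phi>) ^ (n - s) * b ^ s * (\<Prod>i<k. real m - real i) *
        noncentral_stirling s k 0 = b ^ n * (\<Prod>i<k. real m - real i) *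
        (real (n choose s) * \<phi> ^ (n - s) * noncentral_stirling s k 0)"
      by (simp add: power_mult_distrib)
  qed
  finally show ?thesis
    by (simp only: sum_distrib_left[symmetric] noncentral_stirling_convolution)
qed

section \<open>Law of the first n balls\<close>

context extended_occupancy
begin

abbreviation ball :: "nat \<Rightarrow> 'a \<Rightarrow> nat option"
  where "ball \<equiv> occ_ball Ut Q"

lemma Ut_measurable: "i \<ge> 1 \<Longrightarrow> Ut i \<in> measurable M (count_space UNIV)"
  and Q_measurable: "i \<ge> 1 \<Longrightarrow> Q i \<in> measurable M (count_space UNIV)"
  using Ut_indep Q_indep by (auto simp: indep_vars_def)

lemma ball_measurable [measurable]:
  assumes "i \<ge> 1"
  shows "ball i \<in> measurable M (count_space UNIV)"
proof -
  note [measurable] = Ut_measurable[OF assms] Q_measurable[OF assms]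
  show ?thesis
    unfolding occ_ball_def by measurable
qed

lemma prob_Ut:
  assumes "i \<ge> 1" "m \<ge> 1" "l \<in> {1..m}"
  shows "prob {\<omega> \<in> space M. Ut i \<omega> = l} = 1 / real m"
proof -
  have "prob {\<omega> \<in> space M. Ut i \<omega> = l} = measure (distr M (count_space UNIV) (Ut i)) {l}"
    using Ut_measurable[OF assms(1)] by (subst measure_distr) (auto intro!: arg_cong[where f = prob])
  also have "\<dots> = 1 / real m"
    using assms by (simp add: Ut_distr measure_pmf_single)
  finally show ?thesis .
qed

lemma prob_Q_eq_0:
  assumes "i \<ge> 1" "0 \<le> \<theta>" "\<theta> \<le> 1"
  shows "prob {\<omega> \<in> space M. Q i \<omega> = 0} = 1 - \<theta>"
proof -
  have "prob {\<omega> \<in> space M. Q i \<omega> = 0} = measure (distr M (count_space UNIV) (Q i)) {0}"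
    using Q_measurable[OF assms(1)] by (subst measure_distr) (auto intro!: arg_cong[where f = prob])
  also have "\<dots> = measure (measure_pmf (bernoulli_pmf \<theta>)) {False}"
    using assms by (simp add: Q_distr) (auto intro!: arg_cong[where f = "measure _"])
  also have "\<dots> = 1 - \<theta>"
    using assms by (simp add: measure_pmf_single)
  finally show ?thesis .
qed

lemma prob_Q_neq_0:
  assumes "i \<ge> 1" "0 \<le> \<theta>" "\<theta> \<le> 1"
  shows "prob {\<omega> \<in> space M. Q i \<omega> \<noteq> 0} = \<theta>"
proof -
  note [measurable] = Q_measurable[OF assms(1)]
  have "{\<omega> \<in> space M. Q i \<omega> = 0} \<in> events"
    by measurable
  from prob_neg[OF this] show ?thesis
    using prob_Q_eq_0[OF assms] by simp
qed

text \<open>Independence of the two sequences separates a cylinder in \<open>Ut\<close> from one in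
  \<open>Q\<close>; independence within each sequence then factors both over the balls.\<close>

lemma prob_Ut_Q_cylinder:
  "prob {\<omega> \<in> space M. \<forall>i\<in>{1..n}. Ut i \<omega> \<in> A i \<and> Q i \<omega> \<in> B i} =
     (\<Prod>i=1..n. prob {\<omega> \<in> space M. Ut i \<omega> \<in> A i} * prob {\<omega> \<in> space M. Q i \<omega> \<in> B i})"
proof -
  let ?P = "PiM {1..} (\<lambda>_. count_space UNIV) :: (nat \<Rightarrow> nat) measure"
  let ?C = "\<lambda>A. {f \<in> space ?P. \<forall>i\<in>{1..n}. f i \<in> A i}"
  have C: "?C A \<in> sets ?P" for A :: "nat \<Rightarrow> nat set"
    by measurable
  have prod: "prob {\<omega> \<in> space M. \<forall>i\<in>{1..n}. X i \<omega> \<in> A i} = (\<Prod>i=1..n. prob {\<omega> \<in> space M. X i \<omega> \<in> A i})"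
    if X: "indep_vars (\<lambda>_. count_space UNIV) X {1..}" for X :: "nat \<Rightarrow> 'a \<Rightarrow> nat" and A
  \<comment> \<open>The empty intersection would be \<open>UNIV\<close> rather than
    \<open>space M\<close>, so n = 0 is treated apart.\<close>
  proof (cases "n = 0")
    case True
    then show ?thesis by (simp add: prob_space)
  next
    case False
    then have "prob (\<Inter>i\<in>{1..n}. X i -` A i \<inter> space M) = (\<Prod>i=1..n. prob (X i -` A i \<inter> space M))"
      by (intro indep_varsD[OF X]) auto
    moreover have "(\<Inter>i\<in>{1..n}. X i -` A i \<inter> space M) = {\<omega> \<in> space M. \<forall>i\<in>{1..n}. X i \<omega> \<in> A i}"
      using False by auto
    ultimately show ?thesis
      by (simp add: vimage_def Int_def conj_commute)
  qed
  have restr: "(\<lambda>\<omega>. \<lambda>i\<in>{1..}. X i \<omega>) -` ?C A \<inter> space M = {\<omega> \<in> space M. \<forall>i\<in>{1..n}. X i \<omega> \<in> A i}"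
    for X :: "nat \<Rightarrow> 'a \<Rightarrow> nat" and A
    by (auto simp: space_PiM)
  have "prob ((\<lambda>\<omega>. (\<lambda>i\<in>{1..}. Ut i \<omega>, \<lambda>i\<in>{1..}. Q i \<omega>)) -` (?C A \<times> ?C B) \<inter> space M) =
      prob ((\<lambda>\<omega>. \<lambda>i\<in>{1..}. Ut i \<omega>) -` ?C A \<inter> space M) * prob ((\<lambda>\<omega>. \<lambda>i\<in>{1..}. Q i \<omega>) -` ?C B \<inter> space M)"
    by (rule indep_varD[OF Ut_Q_indep C C])
  moreover have "(\<lambda>\<omega>. (\<lambda>i\<in>{1..}. Ut i \<omega>, \<lambda>i\<in>{1..}. Q i \<omega>)) -` (?C A \<times> ?C B) \<inter> space M =
      {\<omega> \<in> space M. \<forall>i\<in>{1..n}. Ut i \<omega> \<in> A i \<and> Q i \<omega> \<in> B i}"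
    by (auto simp: space_PiM)
  ultimately show ?thesis
    by (simp only: restr prod[OF Ut_indep] prod[OF Q_indep] prod.distrib)
qed

text \<open>Each condition on a ball is a rectangle in (\<open>Ut i\<close>, \<open>Q i\<close>): a
  lost ball leaves \<open>Ut i\<close> free, a ball in bin l fixes it. The cylinder formula
  therefore applies.\<close>

lemma prob_ball_seq:
  assumes "m \<ge> 1" "0 \<le> \<theta>" "\<theta> \<le> 1" "u \<in> ball_seqs m n"
  shows "prob {\<omega> \<in> space M. \<forall>i\<in>{1..n}. ball i \<omega> = u i} = seq_weight (1 - \<theta>) (\<theta> / real m) n u"
proof -
  define A where "A i = (case u i of None \<Rightarrow> UNIV | Some l \<Rightarrow> {l})" for i
  \<comment> \<open>The complement of 0 rather than the set of 1 matches the test in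
    \<open>occ_ball\<close>, so the equivalence below holds pointwise.\<close>
  define B where "B i = (case u i of None \<Rightarrow> {0::nat} | Some l \<Rightarrow> - {0})" for i
  have "ball i \<omega> = u i \<longleftrightarrow> Ut i \<omega> \<in> A i \<and> Q i \<omega> \<in> B i" for i \<omega>
    by (auto simp: A_def B_def occ_ball_def split: option.splits)
  then have "prob {\<omega> \<in> space M. \<forall>i\<in>{1..n}. ball i \<omega> = u i} =
      (\<Prod>i=1..n. prob {\<omega> \<in> space M. Ut i \<omega> \<in> A i} * prob {\<omega> \<in> space M. Q i \<omega> \<in> B i})"
    by (simp only: prob_Ut_Q_cylinder)
  also have "\<dots> = seq_weight (1 - \<theta>) (\<theta> / real m) n u"
    unfolding seq_weight_def
  proof (rule prod.cong[OF refl])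
    fix i assume i: "i \<in> {1..n}"
    show "prob {\<omega> \<in> space M. Ut i \<omega> \<in> A i} * prob {\<omega> \<in> space M. Q i \<omega> \<in> B i} =
        ball_weight (1 - \<theta>) (\<theta> / real m) (u i)"
    proof (cases "u i")
      case None
      then show ?thesis
        using i assms by (simp add: A_def B_def ball_weight_def prob_space prob_Q_eq_0)
    next
      case (Some l)
      then have "l \<in> {1..m}"
        using i assms(4) by (force simp: ball_seqs_def dest: PiE_mem)
      then show ?thesis
        using Some i assms prob_Ut[of i l] prob_Q_neq_0[of i]
        by (simp add: A_def B_def ball_weight_def)
    qed
  qed
  finally show ?thesis .
qed

text \<open>Only the distribution of \<open>Ut i\<close> is given, so values outside the bins are
  excluded up to a null set.\<close>

lemma AE_ball:
  assumes "m \<ge> 1" "i \<ge> 1"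
  shows "AE \<omega> in M. ball i \<omega> \<in> insert None (Some ` {1..m})"
proof -
  have "AE l in distr M (count_space UNIV) (Ut i). l \<in> {1..m}"
    unfolding Ut_distr[OF assms(2)] AE_measure_pmf_iff using assms(1) by simp
  then have "AE \<omega> in M. Ut i \<omega> \<in> {1..m}"
    using Ut_measurable[OF assms(2)] by (subst (asm) AE_distr_iff) auto
  then show ?thesis
    by eventually_elim (auto simp: occ_ball_def)
qed

text \<open>Transfers probabilities to the finite enumeration: up to a null set, an event determined
  by the first n balls is the disjoint union of the events that the path equals u, over the
  sequences u satisfying \<open>R\<close>.\<close>

lemma prob_ball_law:
  assumes "m \<ge> 1" "0 \<le> \<theta>" "\<theta> \<le> 1"
    and ev: "{\<omega> \<in> space M. R (\<lambda>i\<in>{1..n}. ball i \<omega>)} \<in> events"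
  shows "\<P>(\<omega> in M. R (\<lambda>i\<in>{1..n}. ball i \<omega>)) =
         (\<Sum>u\<in>ball_seqs m n. of_bool (R u) * seq_weight (1 - \<theta>) (\<theta> / real m) n u)"
proof -
  \<comment> \<open>Members of \<open>ball_seqs\<close> are extensional, so agreement on the first n
    indices determines u; this gives disjointness.\<close>
  have eq: "(\<forall>i\<in>{1..n}. ball i \<omega> = u i) \<longleftrightarrow> u = (\<lambda>i\<in>{1..n}. ball i \<omega>)" if "u \<in> ball_seqs m n" for u \<omega>
    using that by (fastforce simp: ball_seqs_def PiE_def extensional_def)
  have "AE \<omega> in M. \<forall>i\<in>{1..n}. ball i \<omega> \<in> insert None (Some ` {1..m})"
    using AE_ball[OF assms(1)] by (intro AE_finite_allI) auto
  then have "AE \<omega> in M. (\<lambda>i\<in>{1..n}. ball i \<omega>) \<in> ball_seqs m n"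
    by eventually_elim (auto simp: ball_seqs_def)
  then have "\<P>(\<omega> in M. R (\<lambda>i\<in>{1..n}. ball i \<omega>)) =
      (\<Sum>u\<in>{u \<in> ball_seqs m n. R u}. \<P>(\<omega> in M. \<forall>i\<in>{1..n}. ball i \<omega> = u i))"
  proof (intro prob_sum)
    show "{\<omega> \<in> space M. \<forall>i\<in>{1..n}. ball i \<omega> = u i} \<in> events" for u
      by measurable
    assume "AE \<omega> in M. (\<lambda>i\<in>{1..n}. ball i \<omega>) \<in> ball_seqs m n"
    then show "AE \<omega> in M. (\<forall>u\<in>{u \<in> ball_seqs m n. R u}.
          (\<forall>i\<in>{1..n}. ball i \<omega> = u i) \<longrightarrow> R (\<lambda>i\<in>{1..n}. ball i \<omega>)) \<and>
        (R (\<lambda>i\<in>{1..n}. ball i \<omega>) \<longrightarrow>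
          (\<exists>!u. u \<in> {u \<in> ball_seqs m n. R u} \<and> (\<forall>i\<in>{1..n}. ball i \<omega> = u i)))"
    proof eventually_elim
      case (elim \<omega>)
      then have "u \<in> {u \<in> ball_seqs m n. R u} \<and> (\<forall>i\<in>{1..n}. ball i \<omega> = u i) \<longleftrightarrow>
          u = (\<lambda>i\<in>{1..n}. ball i \<omega>) \<and> R (\<lambda>i\<in>{1..n}. ball i \<omega>)" for u
        using eq[of u \<omega>] by auto
      then show ?case
        by (intro conjI ballI impI ex1I[of _ "\<lambda>i\<in>{1..n}. ball i \<omega>"]) (fast | simp only:)+
    qed
  qed (use ev finite_ball_seqs in auto)
  also have "\<dots> = (\<Sum>u\<in>{u \<in> ball_seqs m n. R u}. seq_weight (1 - \<theta>) (\<theta> / real m) n u)"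
    using prob_ball_seq[OF assms(1-3)] by (intro sum.cong refl) auto
  also have "\<dots> = (\<Sum>u\<in>ball_seqs m n. of_bool (R u) * seq_weight (1 - \<theta>) (\<theta> / real m) n u)"
    using finite_ball_seqs by (intro sum.mono_neutral_cong_left) auto
  finally show ?thesis .
qed

section \<open>Joint, marginal and conditional laws of the two counts\<close>

lemma seq_effective_ball: "seq_effective n (\<lambda>i\<in>{1..n}. ball i \<omega>) = effective_balls ball n \<omega>"
  by (simp add: effective_balls_def)

lemma seq_occupancy_ball: "seq_occupancy m n (\<lambda>i\<in>{1..n}. ball i \<omega>) = occupancy_number m ball n \<omega>"
  by (simp add: occupancy_number_def)

lemma effective_balls_measurable [measurable]:
  "effective_balls ball n \<in> measurable M (count_space UNIV)"
  unfolding effective_balls_def by measurable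

lemma occupancy_number_measurable [measurable]:
  "occupancy_number m ball n \<in> measurable M (count_space UNIV)"
  unfolding occupancy_number_def by measurable

lemma prob_effective_occupancy:
  assumes "m \<ge> 1" "0 \<le> \<theta>" "\<theta> \<le> 1"
  shows "\<P>(\<omega> in M. effective_balls ball n \<omega> = s \<and> occupancy_number m ball n \<omega> = k) =
    real (n choose s) * (1 - \<theta>) ^ (n - s) * (\<theta> / real m) ^ s * (\<Prod>i<k. real m - real i) *
    noncentral_stirling s k 0"
proof -
  have "{\<omega> \<in> space M. effective_balls ball n \<omega> = s \<and> occupancy_number m ball n \<omega> = k} \<in> events"
    by measurable
  then show ?thesis
    using prob_ball_law[OF assms, of "\<lambda>u. seq_effective n u = s \<and> seq_occupancy m n u = k" n]
    by (simp add: seq_effective_ball seq_occupancy_ball sum_seq_weight del: One_nat_def)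
qed

lemma prob_occupancy:
  assumes "m \<ge> 1" "0 < \<theta>" "\<theta> \<le> 1"
  shows "\<P>(\<omega> in M. occupancy_number m ball n \<omega> = k) =
    (\<theta> / real m) ^ n * (\<Prod>i<k. real m - real i) *
    noncentral_stirling n k (real m * ((1 - \<theta>) / \<theta>))"
proof -
  have "{\<omega> \<in> space M. occupancy_number m ball n \<omega> = k} \<in> events"
    by measurable
  \<comment> \<open>Solving 1 - \<theta> = b \<phi> with b = \<theta> / m is what determines the
    spillage parameter.\<close>
  moreover have "1 - \<theta> = \<theta> / real m * (real m * ((1 - \<theta>) / \<theta>))"
    using assms by simp
  ultimately show ?thesis
    using assms prob_ball_law[of "\<lambda>u. seq_occupancy m n u = k" n]
      sum_seq_weight_occupancy[of m n k "\<theta> / real m" "real m * ((1 - \<theta>) / \<theta>)"]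
    by (simp add: seq_occupancy_ball del: One_nat_def)
qed

text \<open>The joint and the marginal law share the factor b^n (m)_k, which cancels in the
  quotient.\<close>

lemma cond_prob_effective_occupancy:
  assumes "m \<ge> 1" "0 < \<theta>" "\<theta> \<le> 1" "1 \<le> k" "k \<le> min n m" "s \<in> {k..n}"
  shows "\<P>(\<omega> in M. effective_balls ball n \<omega> = s \<bar> occupancy_number m ball n \<omega> = k) =
    spillage (s - k) n k (real m * ((1 - \<theta>) / \<theta>))"
proof -
  define \<phi> where "\<phi> = real m * ((1 - \<theta>) / \<theta>)"
  define b where "b = \<theta> / real m"
  define F where "F = (\<Prod>i<k. real m - real i)"
  \<comment> \<open>Each factor m - i of \<open>F\<close> is nonzero since i < k \<le> m.\<close>
  have nz: "b \<noteq> 0" "F \<noteq> 0"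
    using assms by (auto simp: b_def F_def)
  have "1 - \<theta> = b * \<phi>"
    using assms by (simp add: b_def \<phi>_def)
  moreover have "b ^ n = b ^ (n - s) * b ^ s"
    using assms by (simp flip: power_add)
  ultimately have "real (n choose s) * (1 - \<theta>) ^ (n - s) * b ^ s * F * noncentral_stirling s k 0 =
      (b ^ n * F) * (real (n choose s) * \<phi> ^ (n - s) * noncentral_stirling s k 0)"
    by (simp add: power_mult_distrib)
  then have "\<P>(\<omega> in M. effective_balls ball n \<omega> = s \<bar> occupancy_number m ball n \<omega> = k) =
      (b ^ n * F) * (real (n choose s) * \<phi> ^ (n - s) * noncentral_stirling s k 0) /
      ((b ^ n * F) * noncentral_stirling n k \<phi>)"
    unfolding cond_prob_def using assms
    by (simp only: prob_effective_occupancy[OF _ less_imp_le] prob_occupancy flip: b_def F_def \<phi>_def)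
  also have "\<dots> = real (n choose s) * \<phi> ^ (n - s) * noncentral_stirling s k 0 / noncentral_stirling n k \<phi>"
    using nz by simp
  also have "\<dots> = spillage (s - k) n k \<phi>"
  \<comment> \<open>For \<phi> = 0, that is \<theta> = 1, \<open>spillage\<close> is an indicator by
    definition. The quotient agrees: \<open>\<phi> ^ (n - s)\<close> vanishes unless s = n, where it
    is 1 and the equal positive Stirling numbers cancel.\<close>
  proof (cases "\<phi> = 0")
    case True
    then have "noncentral_stirling n k \<phi> \<noteq> 0"
      using noncentral_stirling_pos[of \<phi> k n] assms by simp
    moreover have "s - k = n - k \<longleftrightarrow> s = n"
      using assms by auto
    ultimately show ?thesis
      using True assms by (auto simp: spillage_def)
  next
    case False
    then show ?thesis
      using assms by (simp add: spillage_def)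
  qed
  finally show ?thesis
    unfolding \<phi>_def .
qed

end

theorem mainTheorem5:
  fixes M :: "'a measure" and m n k :: nat and \<theta> :: real
    and Ut :: "nat \<Rightarrow> 'a \<Rightarrow> nat" and Q :: "nat \<Rightarrow> 'a \<Rightarrow> nat"
  defines "U \<equiv> occ_ball Ut Q"
  assumes "m \<ge> 1" and "n \<ge> 1" and "0 < \<theta>" and "\<theta> \<le> 1"
    and "extended_occupancy M m \<theta> Ut Q"
    and "1 \<le> k" and "k \<le> min n m"
  shows "(\<forall>r\<in>{0..n - k}.
            \<P>(\<omega> in M. int (effective_balls U n \<omega>) - int (occupancy_number m U n \<omega>) = int r
                \<bar> occupancy_number m U n \<omega> = k)
            = spillage r n k (real m * ((1 - \<theta>) / \<theta>))) \<and>
         (\<forall>s\<in>{k..n}.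
            \<P>(\<omega> in M. effective_balls U n \<omega> = s \<bar> occupancy_number m U n \<omega> = k)
            = spillage (s - k) n k (real m * ((1 - \<theta>) / \<theta>)))"
proof -
  interpret extended_occupancy M m \<theta> Ut Q by fact
  have law: "\<P>(\<omega> in M. effective_balls U n \<omega> = s \<bar> occupancy_number m U n \<omega> = k) =
      spillage (s - k) n k (real m * ((1 - \<theta>) / \<theta>))" if "s \<in> {k..n}" for s
    unfolding U_def using that assms by (intro cond_prob_effective_occupancy) auto
  have "\<P>(\<omega> in M. int (effective_balls U n \<omega>) - int (occupancy_number m U n \<omega>) = int r
          \<bar> occupancy_number m U n \<omega> = k) = spillage r n k (real m * ((1 - \<theta>) / \<theta>))"
    if "r \<in> {0..n - k}" for r
  proof -
    \<comment> \<open>On the conditioning event the difference is r exactly when the effective count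
      is k + r, so the first claim is the second at s = k + r.\<close>
    have "int (effective_balls U n \<omega>) - int (occupancy_number m U n \<omega>) = int r \<and> occupancy_number m U n \<omega> = k
        \<longleftrightarrow> effective_balls U n \<omega> = k + r \<and> occupancy_number m U n \<omega> = k" for \<omega>
      by auto
    then have "\<P>(\<omega> in M. int (effective_balls U n \<omega>) - int (occupancy_number m U n \<omega>) = int r
          \<bar> occupancy_number m U n \<omega> = k) =
        \<P>(\<omega> in M. effective_balls U n \<omega> = k + r \<bar> occupancy_number m U n \<omega> = k)"
      unfolding cond_prob_def by simp
    moreover have "k + r \<in> {k..n}"
      using that \<open>k \<le> min n m\<close> by auto
    ultimately show ?thesis
      using law[of "k + r"] by (simp only: diff_add_inverse)
  qed
  with law show ?thesis
    by blast
qed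

end
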